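(* If $X$ is an SL space, then $X$ is selectively $2$-star-ccc. In general, for each positive integer $k$, every $k$-SL space is selectively $(k+1)$-star-ccc.
   Context: For an open cover $\mathcal{U}$ of a topological space $X$ and $A\subset X$, put $\operatorname{st}^1(A,\mathcal{U})=\bigcup\{U\in\mathcal{U}:U\cap A\neq\emptyset\}$ and inductively $\operatorname{st}^{n+1}(A,\mathcal{U})=\bigcup\{U\in\mathcal{U}:U\cap \operatorname{st}^n(A,\mathcal{U})\neq\emptyset\}$. For a positive integer $k$, $X$ is $k$-SL ($k$-star-Lindelöf) if for every open cover $\mathcal{U}$ of $X$ there is a countable $\mathcal{U}'\subset\mathcal{U}$ with $\operatorname{st}^k(\bigcup\mathcal{U}',\mathcal{U})=X$; SL means $1$-SL. For a positive integer $k$, $X$ is selectively $k$-star-ccc if for every open cover $\mathcal{U}$ of $X$ and every sequence $(\mathcal{A}_n:n\in\omega)$ of maximal pairwise disjoint open families of $X$, there is a sequence $(A_n:n\in\omega)$ with $A_n\in\mathcal{A}_n$ for all $n$ such that $\operatorname{st}^k(\bigcup_{n\in\omega}A_n,\mathcal{U})=X$. *)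

theory Defs
  imports "HOL-Analysis.Abstract_Topology" "HOL-Library.Countable_Set" "HOL-Library.Disjoint_Sets"
begin

definition open_cover :: "'a topology \<Rightarrow> 'a set set \<Rightarrow> bool" where
  "open_cover X \<U> \<longleftrightarrow> (\<forall>U\<in>\<U>. openin X U) \<and> \<Union>\<U> = topspace X"

definition star :: "'a set set \<Rightarrow> 'a set \<Rightarrow> 'a set" where
  "star \<U> A = \<Union>{U \<in> \<U>. U \<inter> A \<noteq> {}}"

text \<open>The iterated star \<open>st\<^sup>n(A, \<U>)\<close>. Only \<open>n \<ge> 1\<close> is meaningful;
  the value at \<open>0\<close> is the artefact \<open>A\<close>.\<close>

definition iter_star :: "nat \<Rightarrow> 'a set \<Rightarrow> 'a set set \<Rightarrow> 'a set" where
  "iter_star n A \<U> = (star \<U> ^^ n) A"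

definition star_Lindelof :: "nat \<Rightarrow> 'a topology \<Rightarrow> bool" where
  "star_Lindelof k X \<longleftrightarrow>
    (\<forall>\<U>. open_cover X \<U> \<longrightarrow>
      (\<exists>\<U>'\<subseteq>\<U>. countable \<U>' \<and> iter_star k (\<Union>\<U>') \<U> = topspace X))"

abbreviation SL_space :: "'a topology \<Rightarrow> bool" where
  "SL_space X \<equiv> star_Lindelof 1 X"

definition disjoint_open_family :: "'a topology \<Rightarrow> 'a set set \<Rightarrow> bool" where
  "disjoint_open_family X \<A> \<longleftrightarrow> (\<forall>A\<in>\<A>. openin X A) \<and> disjoint \<A>"

text \<open>Maximality is with respect to inclusion of families. The empty set is disjoint from every set
  and hence belongs to every maximal family. For a nonempty space, restricting to families of
  nonempty open sets gives an equivalent notion of selectively star-ccc space; for the empty space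
  it would not, since the only such family is \<open>{}\<close>, from which nothing can be selected.\<close>

definition maximal_disjoint_open_family :: "'a topology \<Rightarrow> 'a set set \<Rightarrow> bool" where
  "maximal_disjoint_open_family X \<A> \<longleftrightarrow>
    disjoint_open_family X \<A> \<and>
    (\<forall>\<B>. disjoint_open_family X \<B> \<and> \<A> \<subseteq> \<B> \<longrightarrow> \<B> = \<A>)"

definition selectively_star_ccc :: "nat \<Rightarrow> 'a topology \<Rightarrow> bool" where
  "selectively_star_ccc k X \<longleftrightarrow>
    (\<forall>\<U> \<A>. open_cover X \<U> \<and> (\<forall>n::nat. maximal_disjoint_open_family X (\<A> n)) \<longrightarrow>
      (\<exists>A. (\<forall>n. A n \<in> \<A> n) \<and> iter_star k (\<Union>n. A n) \<U> = topspace X))"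

end

theory Submission
  imports Defs
begin

text \<open>Enumerate a countable family \<open>U\<^sub>n\<close> witnessing the \<open>k\<close>-star-Lindelof property. A maximal
  disjoint open family meets every nonempty open set, so one can select \<open>A\<^sub>n\<close> meeting \<open>U\<^sub>n\<close>. Then
  each \<open>U\<^sub>n\<close> lies in the first star of the union of the \<open>A\<^sub>n\<close>, and \<open>k\<close> further stars cover the space.\<close>

lemma star_mono: "A \<subseteq> B \<Longrightarrow> star \<U> A \<subseteq> star \<U> B"
  unfolding star_def by blast

lemma star_subset_Union: "star \<U> A \<subseteq> \<Union>\<U>"
  unfolding star_def by blast

lemma iter_star_mono: "A \<subseteq> B \<Longrightarrow> iter_star n A \<U> \<subseteq> iter_star n B \<U>"
  unfolding iter_star_def by (induction n) (simp_all add: star_mono)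

lemma iter_star_Suc: "iter_star (Suc n) A \<U> = star \<U> (iter_star n A \<U>)"
  by (simp add: iter_star_def)

text \<open>Splits off the innermost star, which is spent on getting from the selected sets to
  \<open>\<Union>\<U>'\<close>.\<close>

lemma iter_star_Suc_right: "iter_star (Suc n) A \<U> = iter_star n (star \<U> A) \<U>"
  by (simp add: iter_star_def funpow_Suc_right del: funpow.simps)

text \<open>The disjunct \<open>V = {}\<close> also records that a maximal family is nonempty.\<close>

lemma maximal_disjoint_open_family_meets:
  assumes max: "maximal_disjoint_open_family X \<A>" and V: "openin X V"
  shows "\<exists>A\<in>\<A>. V = {} \<or> V \<inter> A \<noteq> {}"
proof (rule ccontr)
  assume "\<not> ?thesis"
  then have none: "V \<noteq> {} \<and> V \<inter> A = {}" if "A \<in> \<A>" for A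
    using that by blast
  \<comment> \<open>For empty \<open>\<A>\<close>, \<open>none\<close> is vacuous and
    \<open>{V}\<close> is still a disjoint open family.\<close>
  have "disjoint_open_family X (insert V \<A>)"
    using max V none
    by (auto simp: maximal_disjoint_open_family_def disjoint_open_family_def pairwise_insert
        disjnt_def Int_commute)
  then have "V \<in> \<A>"
    using max unfolding maximal_disjoint_open_family_def by blast
  \<comment> \<open>\<open>none\<close> at \<open>V\<close> itself makes \<open>V \<inter> V\<close>
    empty for a nonempty \<open>V\<close>.\<close>
  then show False using none by blast
qed

lemma star_Lindelof_imp_selectively_star_ccc:
  assumes "star_Lindelof k X"
  shows "selectively_star_ccc (Suc k) X"
  unfolding selectively_star_ccc_def
proof (intro allI impI, elim conjE)
  fix \<U> and \<A> :: "nat \<Rightarrow> 'a set set"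
  assume cover: "open_cover X \<U>"
    and max: "\<forall>n. maximal_disjoint_open_family X (\<A> n)"
  obtain \<U>' where sub: "\<U>' \<subseteq> \<U>" and "countable \<U>'"
    and st: "iter_star k (\<Union>\<U>') \<U> = topspace X"
    using assms cover unfolding star_Lindelof_def by meson
  \<comment> \<open>\<open>\<U>'\<close> may be empty, hence not the range of a sequence.\<close>
  obtain U :: "nat \<Rightarrow> 'a set" where U: "range U = insert {} \<U>'"
    using range_from_nat_into[OF insert_not_empty countable_insert[OF \<open>countable \<U>'\<close>]]
    by (rule that)
  have "openin X (U n)" for n
  proof -
    have "U n \<in> insert {} \<U>'" using U by blast
    then show ?thesis using sub cover unfolding open_cover_def by auto
  qed
  \<comment> \<open>Where \<open>U n\<close> is the padding \<open>{}\<close>, any member of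
    \<open>\<A> n\<close> may be chosen.\<close>
  then have "\<forall>n. \<exists>A. A \<in> \<A> n \<and> (U n = {} \<or> U n \<inter> A \<noteq> {})"
    using maximal_disjoint_open_family_meets[OF max[rule_format]] unfolding Bex_def by simp
  from choice[OF this] obtain A
    where A: "A n \<in> \<A> n" and meet: "U n = {} \<or> U n \<inter> A n \<noteq> {}" for n
    by auto
  have "\<Union>\<U>' \<subseteq> star \<U> (\<Union>n. A n)"
  proof (rule Union_least)
    fix V assume V: "V \<in> \<U>'"
    then have "V \<in> range U" using U by simp
    then obtain n where n: "V = U n" by (rule rangeE)
    show "V \<subseteq> star \<U> (\<Union>n. A n)"
    proof (cases "V = {}")
      case False
      then have "V \<inter> (\<Union>n. A n) \<noteq> {}" using meet[of n] n by auto
      \<comment> \<open>\<open>V\<close> is itself a member of \<open>\<U>\<close> meeting the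
        union, hence one of the sets forming the star.\<close>
      then show ?thesis using V sub unfolding star_def by auto
    qed simp
  qed
  then have "topspace X \<subseteq> iter_star (Suc k) (\<Union>n. A n) \<U>"
    unfolding iter_star_Suc_right st[symmetric] by (rule iter_star_mono)
  \<comment> \<open>The outermost star is a union of members of the cover, even for
    \<open>k = 0\<close>.\<close>
  moreover have "iter_star (Suc k) (\<Union>n. A n) \<U> \<subseteq> topspace X"
    using star_subset_Union[of \<U> "iter_star k (\<Union>n. A n) \<U>"] cover
    by (simp add: iter_star_Suc open_cover_def)
  ultimately show "\<exists>A. (\<forall>n. A n \<in> \<A> n) \<and> iter_star (Suc k) (\<Union>n. A n) \<U> = topspace X"
    using A by (intro exI[of _ A]) simp
qed

theorem theorem2p2:
  fixes X :: "'a topology"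
  shows "(SL_space X \<longrightarrow> selectively_star_ccc 2 X) \<and>
    (\<forall>k\<ge>1. star_Lindelof k X \<longrightarrow> selectively_star_ccc (k + 1) X)"
  using star_Lindelof_imp_selectively_star_ccc[of _ X]
  by (auto simp: numeral_2_eq_2)

end
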